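(* Let $\omega=\mathcal{A}(\theta)$ ($\theta\in[0,1)$) be a positive quadratic irrational number and let $\omega'$ be its algebraic conjugate. Then (1) $\omega$ is a pure quadratic irrational number if and only if $\omega'<0$; (2) $\omega$ is a non-pure quadratic irrational number if and only if $\omega'>0$.
   Context: Stern's diatomic integers: $[2^0:0]=0$, $[2^0:1]=1$, $[2^{n+1}:2m]=[2^n:m]$, $[2^{n+1}:2m+1]=[2^n:m]+[2^n:m+1]$. Assembly function: the map $m/2^n\mapsto[2^n:m]/[2^n:2^n-m]$ ($0\le m\le 2^n-1$) extends uniquely to a continuous strictly increasing bijection $\mathcal{A}:[0,1)\to[0,\infty)$. An infinite design is an infinite binary sequence $d_1d_2\cdots$ that is not eventually constant, with design decimal $\theta_D=\sum_i d_i2^{-i}$; it is purely periodic if $D=PPP\cdots$ for some nonempty finite binary word $P$. $\omega=\mathcal{A}(\theta)$ is a pure quadratic irrational number if $\theta=\theta_D$ for a purely periodic infinite design $D$, and a non-pure quadratic irrational number if it is a quadratic irrational but not pure. *)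

theory Defs
  imports "HOL-Analysis.Analysis"
begin

text \<open>\<^term>\<open>stern n m\<close> is Stern's diatomic integer $[2^n:m]$; only arguments with
  \<open>m \<le> 2 ^ n\<close> are meaningful.\<close>

fun stern :: "nat \<Rightarrow> nat \<Rightarrow> nat" where
  "stern 0 m = (if m = 0 then 0 else 1)"
| "stern (Suc n) m =
     (if even m then stern n (m div 2) else stern n (m div 2) + stern n (m div 2 + 1))"

lemma stern_recurrence:
  "stern 0 0 = 0"
  "stern 0 1 = 1"
  "stern (Suc n) (2 * m) = stern n m"
  "stern (Suc n) (2 * m + 1) = stern n m + stern n (m + 1)"
  by simp_all

text \<open>The condition \<open>A \<in> extensional {0..<1}\<close> only fixes the irrelevant values of the total
  function \<open>A\<close> outside its domain \<open>[0,1)\<close>, so that the definite description is unique.\<close>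

definition assembly_extension :: "(real \<Rightarrow> real) \<Rightarrow> bool" where
  "assembly_extension A \<longleftrightarrow>
     continuous_on {0..<1} A \<and> strict_mono_on {0..<1} A \<and> bij_betw A {0..<1} {0..} \<and>
     (\<forall>n m. m < 2 ^ n \<longrightarrow>
        A (real m / 2 ^ n) = real (stern n m) / real (stern n (2 ^ n - m))) \<and>
     A \<in> extensional {0..<1}"

definition assembly :: "real \<Rightarrow> real" where
  "assembly = (THE A. assembly_extension A)"

text \<open>Designs are indexed from 0: \<open>d i\<close> is the digit $d_{i+1}$, with \<open>True\<close> for 1.\<close>

definition infinite_design :: "(nat \<Rightarrow> bool) \<Rightarrow> bool" where
  "infinite_design d \<longleftrightarrow> \<not> (\<exists>b N. \<forall>i\<ge>N. d i = b)"

definition design_decimal :: "(nat \<Rightarrow> bool) \<Rightarrow> real" where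
  "design_decimal d = (\<Sum>i. of_bool (d i) / 2 ^ Suc i)"

definition purely_periodic :: "(nat \<Rightarrow> bool) \<Rightarrow> bool" where
  "purely_periodic d \<longleftrightarrow> (\<exists>P. P \<noteq> [] \<and> (\<forall>i. d i = P ! (i mod length P)))"

definition quadratic_irrational :: "real \<Rightarrow> bool" where
  "quadratic_irrational x \<longleftrightarrow> x \<notin> \<rat> \<and>
     (\<exists>a b c :: int. a \<noteq> 0 \<and> of_int a * x\<^sup>2 + of_int b * x + of_int c = 0)"

text \<open>For a quadratic irrational \<open>x\<close>, an integer quadratic vanishing at \<open>x\<close> is a multiple of its
  minimal polynomial, so this is the other root of the minimal polynomial.\<close>

definition quadratic_conjugate :: "real \<Rightarrow> real" where
  "quadratic_conjugate x = (THE y. y \<noteq> x \<and>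
     (\<exists>a b c :: int. a \<noteq> 0 \<and> of_int a * x\<^sup>2 + of_int b * x + of_int c = 0 \<and>
        of_int a * y\<^sup>2 + of_int b * y + of_int c = 0))"

definition pure_quadratic_irrational :: "real \<Rightarrow> bool" where
  "pure_quadratic_irrational \<omega> \<longleftrightarrow>
     (\<exists>\<theta>\<in>{0..<1}. \<omega> = assembly \<theta> \<and>
        (\<exists>d. infinite_design d \<and> purely_periodic d \<and> \<theta> = design_decimal d))"

definition nonpure_quadratic_irrational :: "real \<Rightarrow> bool" where
  "nonpure_quadratic_irrational \<omega> \<longleftrightarrow>
     quadratic_irrational \<omega> \<and> \<not> pure_quadratic_irrational \<omega>"

end

theory Submission
  imports Defs "HOL-Library.Quadratic_Discriminant"
begin

text \<open>
  The assembly function satisfies \<open>A(t/2) = A(t)/(1 + A(t))\<close> and \<open>A((1 + t)/2) = 1 + A(t)\<close>, so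
  dropping the first design digit acts on \<open>\<omega> = A(\<theta>)\<close> by \<open>x \<mapsto> x - 1\<close> if \<open>x > 1\<close> and by
  \<open>x \<mapsto> x/(1 - x)\<close> if \<open>x < 1\<close>. If the design is purely periodic, \<open>\<omega>\<close> is fixed by a Moebius map
  \<open>x \<mapsto> (ax + b)/(cx + e)\<close> with \<open>b, c > 0\<close>, so \<open>\<omega> \<omega>' = -b/c < 0\<close>. Conversely, letting the same
  maps act on both roots preserves the discriminant and the condition \<open>x > 0 > y\<close>. Only finitely
  many pairs of roots with that sign pattern have a given discriminant, and the action on them is
  injective because the sign of \<open>y + 1\<close> reveals which branch was used last; hence the orbit of
  \<open>(\<omega>, \<omega>')\<close> is purely periodic, and so is the design.
\<close>

section \<open>Stern's diatomic integers\<close>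

lemma stern_zero [simp]: "stern n 0 = 0"
  by (induction n) auto

lemma stern_pos: "0 < m \<Longrightarrow> 0 < stern n m"
  by (induction n arbitrary: m) (auto elim!: evenE)

lemma stern_Suc_level: "m \<le> 2 ^ n \<Longrightarrow> stern (Suc n) m = stern n m"
proof (induction n arbitrary: m)
  case 0
  then have "m = 0 \<or> m = 1" by auto
  then show ?case by auto
next
  case (Suc n)
  show ?case
  proof (cases "even m")
    case True
    then obtain k where k: "m = 2 * k" by (elim evenE)
    then have "k \<le> 2 ^ n" using Suc.prems by simp
    from Suc.IH[OF this] show ?thesis by (simp add: k)
  next
    case False
    then obtain k where k: "m = 2 * k + 1" by (elim oddE)
    then have "k + 1 \<le> 2 ^ n" using Suc.prems by simp
    then have "stern (Suc n) k = stern n k" "stern (Suc n) (k + 1) = stern n (k + 1)"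
      using Suc.IH[of k] Suc.IH[of "k + 1"] by (simp_all del: stern.simps)
    then show ?thesis
      unfolding k stern_recurrence by simp
  qed
qed

text \<open>With \<open>stern_Suc_level\<close> this describes a row by its two halves instead of by
  parity of the index. That turns prepending a binary digit into a Moebius map.\<close>

lemma stern_power_add:
  "m \<le> 2 ^ n \<Longrightarrow> stern (Suc n) (2 ^ n + m) = stern n m + stern n (2 ^ n - m)"
proof (induction n arbitrary: m)
  case 0
  then have "m = 0 \<or> m = 1" by auto
  then show ?case by auto
next
  case (Suc n)
  show ?case
  proof (cases "even m")
    case True
    then obtain k where k: "m = 2 * k" by (elim evenE)
    then have le: "k \<le> 2 ^ n" using Suc.prems by simp
    have "2 ^ Suc n + m = 2 * (2 ^ n + k)" "2 ^ Suc n - m = 2 * (2 ^ n - k)"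
      using k by auto
    then show ?thesis
      using Suc.IH[OF le] by (simp only: k stern_recurrence)
  next
    case False
    then obtain k where k: "m = 2 * k + 1" by (elim oddE)
    then have le: "k + 1 \<le> 2 ^ n" using Suc.prems by simp
    have eq: "2 ^ Suc n + m = 2 * (2 ^ n + k) + 1" "2 ^ Suc n - m = 2 * (2 ^ n - (k + 1)) + 1"
      using k le by auto
    \<comment> \<open>The odd recursion at the reflected index asks for the neighbour one to the
      right; with truncated subtraction this needs \<open>k < 2 ^ n\<close>.\<close>
    have "2 ^ n - (k + 1) + 1 = 2 ^ n - k" using le by simp
    then show ?thesis
      using Suc.IH[of k] Suc.IH[of "k + 1"] le
      unfolding eq unfolding k stern_recurrence by (simp add: add.assoc del: stern.simps)
  qed
qed

text \<open>The Farey determinant of neighbouring fractions. Each new row inserts mediants between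
  neighbours, and a mediant leaves the determinant unchanged.\<close>

lemma stern_determinant:
  "m < 2 ^ n \<Longrightarrow>
     stern n (m + 1) * stern n (2 ^ n - m) = stern n m * stern n (2 ^ n - (m + 1)) + 1"
proof (induction n arbitrary: m)
  case 0
  then show ?case by simp
next
  case (Suc n)
  show ?case
  proof (cases "even m")
    case True
    then obtain k where k: "m = 2 * k" by (elim evenE)
    then have le: "k < 2 ^ n" using Suc.prems by simp
    have eq: "2 ^ Suc n - m = 2 * (2 ^ n - k)" "2 ^ Suc n - (m + 1) = 2 * (2 ^ n - (k + 1)) + 1"
      using k le by auto
    have "2 ^ n - (k + 1) + 1 = 2 ^ n - k" using le by simp
    then show ?thesis
      using Suc.IH[OF le]
      unfolding eq unfolding k stern_recurrence by (simp add: algebra_simps del: stern.simps)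
  next
    case False
    then obtain k where k: "m = 2 * k + 1" by (elim oddE)
    then have le: "k < 2 ^ n" using Suc.prems by simp
    have eq: "2 ^ Suc n - m = 2 * (2 ^ n - (k + 1)) + 1" "2 ^ Suc n - (m + 1) = 2 * (2 ^ n - (k + 1))"
      using k le by auto
    have m1: "m + 1 = 2 * (k + 1)" using k by simp
    have "2 ^ n - (k + 1) + 1 = 2 ^ n - k" using le by simp
    then show ?thesis
      using Suc.IH[OF le]
      unfolding eq unfolding m1 unfolding k stern_recurrence by (simp add: algebra_simps del: stern.simps)
  qed
qed

section \<open>Quotients of Stern integers: halves, order and density\<close>

definition stern_ratio :: "nat \<Rightarrow> nat \<Rightarrow> real" where
  "stern_ratio n m = real (stern n m) / real (stern n (2 ^ n - m))"

lemma stern_ratio_zero [simp]: "stern_ratio n 0 = 0"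
  by (simp add: stern_ratio_def)

text \<open>The numerator index stays in the lower half, where the row is copied; the reflected
  denominator index falls into the upper half, where \<open>stern_power_add\<close> adds the
  numerator to the denominator.\<close>

lemma stern_ratio_lower_half:
  assumes "m < 2 ^ n"
  shows "stern_ratio (Suc n) m = stern_ratio n m / (1 + stern_ratio n m)"
proof -
  have "2 ^ Suc n - m = 2 ^ n + (2 ^ n - m)" using assms by simp
  then have "stern (Suc n) (2 ^ Suc n - m) = stern n (2 ^ n - m) + stern n m"
    using stern_power_add[of "2 ^ n - m" n] assms by (simp del: stern.simps)
  moreover have "0 < stern n (2 ^ n - m)" using assms by (simp add: stern_pos)
  ultimately show ?thesis
    using assms by (simp add: stern_ratio_def stern_Suc_level field_simps del: stern.simps)
qed

lemma stern_ratio_upper_half: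
  assumes "m < 2 ^ n"
  shows "stern_ratio (Suc n) (2 ^ n + m) = 1 + stern_ratio n m"
proof -
  have eq: "2 ^ Suc n - (2 ^ n + m) = 2 ^ n - m" by simp
  have "0 < stern n (2 ^ n - m)" using assms by (simp add: stern_pos)
  then show ?thesis
    using assms unfolding stern_ratio_def eq
    by (simp add: stern_power_add stern_Suc_level add_divide_distrib del: stern.simps)
qed

lemma stern_ratio_less_Suc:
  assumes "Suc m < 2 ^ n"
  shows "stern_ratio n m < stern_ratio n (Suc m)"
proof -
  have "stern n m * stern n (2 ^ n - Suc m) < stern n (Suc m) * stern n (2 ^ n - m)"
    using stern_determinant[of m n] assms by simp
  then have "real (stern n m) * real (stern n (2 ^ n - Suc m))
      < real (stern n (Suc m)) * real (stern n (2 ^ n - m))"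
    by (metis of_nat_less_iff of_nat_mult)
  moreover have "0 < stern n (2 ^ n - Suc m)" "0 < stern n (2 ^ n - m)"
    using assms by (simp_all add: stern_pos)
  ultimately show ?thesis
    by (simp add: stern_ratio_def divide_less_eq less_divide_eq)
qed

lemma stern_ratio_strict_mono:
  assumes "m < k" "k < 2 ^ n"
  shows "stern_ratio n m < stern_ratio n k"
  using assms
proof (induction k)
  case (Suc k)
  then show ?case
    using stern_ratio_less_Suc[of k n] by (cases "m = k") (auto intro: less_trans)
qed simp

lemma stern_ratio_double: "stern_ratio (Suc n) (2 * m) = stern_ratio n m"
proof -
  have "2 ^ Suc n - 2 * m = 2 * (2 ^ n - m)" by simp
  then show ?thesis by (simp only: stern_ratio_def stern_recurrence)
qed

text \<open>The ratio depends only on the dyadic number, so dyadics with different exponents can be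
  compared over a common denominator.\<close>

lemma stern_ratio_refine: "stern_ratio (k + n) (2 ^ k * m) = stern_ratio n m"
proof (induction k)
  case (Suc k)
  then show ?case
    using stern_ratio_double[of "k + n" "2 ^ k * m"] by (simp add: mult.assoc)
qed simp

lemma stern_ratio_less:
  assumes "k < 2 ^ l" "real m / 2 ^ n < real k / 2 ^ l"
  shows "stern_ratio n m < stern_ratio l k"
proof -
  have "real m * 2 ^ l < real k * 2 ^ n"
    using assms(2) by (simp add: field_simps)
  then have "real (2 ^ l * m) < real (2 ^ n * k)" by (simp add: mult.commute)
  then have "2 ^ l * m < 2 ^ n * k" by linarith
  moreover have "2 ^ n * k < 2 ^ (n + l)"
    using assms(1) by (simp add: power_add)
  ultimately have "stern_ratio (l + n) (2 ^ l * m) < stern_ratio (n + l) (2 ^ n * k)"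
    by (simp add: stern_ratio_strict_mono add.commute)
  then show ?thesis by (simp add: stern_ratio_refine)
qed

text \<open>Subtractive Euclidean algorithm: \<open>p < q\<close> undoes \<open>x / (1 + x)\<close>,
  \<open>q \<le> p\<close> undoes \<open>1 + x\<close>, and each step decreases
  \<open>p + q\<close>.\<close>

lemma stern_ratio_surj_Rats:
  "0 < q \<Longrightarrow> \<exists>n m. m < 2 ^ n \<and> stern_ratio n m = real p / real q"
proof (induction "p + q" arbitrary: p q rule: less_induct)
  case less
  consider "p = 0" | "0 < p" "p < q" | "q \<le> p" by linarith
  then show ?case
  proof cases
    case 1
    then show ?thesis by (intro exI[of _ 0]) auto
  next
    case 2
    then obtain n m where nm: "m < 2 ^ n" "stern_ratio n m = real p / real (q - p)"
      using less.hyps[of p "q - p"] by auto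
    have "1 + stern_ratio n m = real q / real (q - p)"
      using 2 nm(2) by (simp add: field_simps of_nat_diff)
    then have "stern_ratio (Suc n) m = real p / real q"
      using 2 nm by (simp add: stern_ratio_lower_half)
    moreover have "m < 2 ^ Suc n" using nm(1) by simp
    ultimately show ?thesis by blast
  next
    case 3
    then obtain n m where nm: "m < 2 ^ n" "stern_ratio n m = real (p - q) / real q"
      using less.hyps[of "p - q" q] less.prems by auto
    have "1 + real (p - q) / real q = real p / real q"
      using 3 less.prems by (simp add: field_simps of_nat_diff)
    then have "stern_ratio (Suc n) (2 ^ n + m) = real p / real q"
      using nm by (simp add: stern_ratio_upper_half)
    moreover have "2 ^ n + m < 2 ^ Suc n" using nm(1) by simp
    ultimately show ?thesis by blast
  qed
qed

lemma stern_ratio_dense: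
  assumes "0 \<le> x" "x < y"
  obtains n m where "m < 2 ^ n" "x < stern_ratio n m" "stern_ratio n m < y"
proof -
  obtain r where r: "r \<in> \<rat>" "x < r" "r < y" using Rats_dense_in_real[OF assms(2)] by blast
  obtain p q where "q \<noteq> 0" "\<bar>r\<bar> = real p / real q" using Rats_abs_nat_div_natE[OF r(1)] by metis
  moreover from this obtain n m where "m < 2 ^ n" "stern_ratio n m = real p / real q"
    using stern_ratio_surj_Rats[of q p] by blast
  ultimately show thesis using r assms that[of m n] by simp
qed

lemma dyadic_dense:
  fixes x y :: real
  assumes "0 \<le> x" "x < y" "y \<le> 1"
  obtains n m where "m < 2 ^ n" "x < real m / 2 ^ n" "real m / 2 ^ n < y"
proof -
  obtain n where n: "1 / (y - x) < 2 ^ n" using real_arch_pow[of 2 "1 / (y - x)"] by auto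
  then have n': "1 < 2 ^ n * (y - x)" using assms by (simp add: field_simps)
  \<comment> \<open>The first point strictly above \<open>x\<close> on the grid of mesh
    \<open>1 / 2 ^ n\<close>; since the mesh is below \<open>y - x\<close>, this point is still
    below \<open>y\<close>.\<close>
  define m where "m = nat \<lfloor>2 ^ n * x\<rfloor> + 1"
  have "real m = of_int \<lfloor>2 ^ n * x\<rfloor> + 1"
    using assms by (simp add: m_def)
  then have "2 ^ n * x < real m" "real m \<le> 2 ^ n * x + 1" by linarith+
  then have m: "2 ^ n * x < real m" "real m < 2 ^ n * y" using n' by (auto simp: algebra_simps)
  have "real m < 2 ^ n * 1"
    using m(2) assms(3) by (rule order_less_le_trans[OF _ mult_left_mono]) simp
  then have "real m < real (2 ^ n)" by simp
  then have "m < 2 ^ n" by linarith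
  with m that[of m n] show thesis by (simp add: field_simps)
qed

section \<open>The assembly function\<close>

text \<open>A concrete monotone extension from the dyadics. It serves as the witness that makes the
  definite description in \<open>assembly\<close> evaluable.\<close>

definition stern_sup :: "real \<Rightarrow> real" where
  "stern_sup \<theta> = Sup {stern_ratio n m | n m. m < 2 ^ n \<and> real m / 2 ^ n \<le> \<theta>}"

lemma stern_sup_upper:
  assumes "\<theta> < 1" "m < 2 ^ n" "real m / 2 ^ n \<le> \<theta>"
  shows "stern_ratio n m \<le> stern_sup \<theta>"
proof -
  have "0 \<le> \<theta>" using assms(3) by (rule order_trans[rotated]) simp
  \<comment> \<open>Any dyadic strictly between \<open>\<theta>\<close> and 1 supplies an upper
    bound for the set whose supremum is taken.\<close>
  then obtain l k where lk: "k < 2 ^ l" "\<theta> < real k / 2 ^ l"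
    by (rule dyadic_dense[of \<theta> 1]) (use assms(1) in auto)
  have "bdd_above {stern_ratio n m | n m. m < 2 ^ n \<and> real m / 2 ^ n \<le> \<theta>}"
    by (rule bdd_aboveI[of _ "stern_ratio l k"])
       (use lk in \<open>auto intro!: less_imp_le[OF stern_ratio_less]\<close>)
  then show ?thesis
    unfolding stern_sup_def using assms by (intro cSup_upper) auto
qed

lemma stern_sup_least:
  assumes "0 \<le> \<theta>" "k < 2 ^ l" "\<theta> \<le> real k / 2 ^ l"
  shows "stern_sup \<theta> \<le> stern_ratio l k"
  unfolding stern_sup_def
proof (rule cSup_least)
  have "stern_ratio 0 0 \<in> {stern_ratio n m |n m. m < 2 ^ n \<and> real m / 2 ^ n \<le> \<theta>}"
    using assms(1) by fastforce
  then show "{stern_ratio n m |n m. m < 2 ^ n \<and> real m / 2 ^ n \<le> \<theta>} \<noteq> {}" by blast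
next
  fix r assume "r \<in> {stern_ratio n m |n m. m < 2 ^ n \<and> real m / 2 ^ n \<le> \<theta>}"
  then obtain n m where r: "r = stern_ratio n m" "m < 2 ^ n" "real m / 2 ^ n \<le> \<theta>" by blast
  show "r \<le> stern_ratio l k"
  proof (rule ccontr)
    assume "\<not> r \<le> stern_ratio l k"
    then have "\<not> real m / 2 ^ n < real k / 2 ^ l"
      using r stern_ratio_less[OF assms(2)] by force
    \<comment> \<open>Squeezed between the two bounds at \<open>\<theta>\<close>, the dyadics
      coincide, possibly with different exponents; refining both to level \<open>n + l\<close>
      equates the ratios.\<close>
    then have "real k / 2 ^ l = real m / 2 ^ n" using r assms by linarith
    then have "real (2 ^ n * k) = real (2 ^ l * m)" by (simp add: field_simps)
    then have "2 ^ n * k = 2 ^ l * m" using of_nat_eq_iff by blast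
    then have "stern_ratio l k = stern_ratio n m"
      using stern_ratio_refine[of n l k] stern_ratio_refine[of l n m] by (simp add: add.commute)
    with \<open>\<not> r \<le> stern_ratio l k\<close> r show False by simp
  qed
qed

lemma stern_sup_dyadic:
  assumes "m < 2 ^ n"
  shows "stern_sup (real m / 2 ^ n) = stern_ratio n m"
proof (rule antisym)
  have "real m < real (2 ^ n)" using assms by (simp only: of_nat_less_iff)
  then have "real m / 2 ^ n < 1" by simp
  then show "stern_ratio n m \<le> stern_sup (real m / 2 ^ n)"
    using assms by (simp add: stern_sup_upper)
qed (use assms in \<open>simp add: stern_sup_least\<close>)

text \<open>Two dyadics are placed between the arguments, because a single one would separate the
  suprema only weakly.\<close>

lemma stern_sup_strict_mono:
  assumes "0 \<le> \<theta>" "\<theta> < \<phi>" "\<phi> < 1"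
  shows "stern_sup \<theta> < stern_sup \<phi>"
proof -
  obtain n m where 1: "m < 2 ^ n" "\<theta> < real m / 2 ^ n" "real m / 2 ^ n < \<phi>"
    by (rule dyadic_dense[of \<theta> \<phi>]) (use assms in auto)
  obtain l k where 2: "k < 2 ^ l" "real m / 2 ^ n < real k / 2 ^ l" "real k / 2 ^ l < \<phi>"
    by (rule dyadic_dense[of "real m / 2 ^ n" \<phi>]) (use assms 1 in auto)
  have "stern_sup \<theta> \<le> stern_ratio n m" using 1 assms by (simp add: stern_sup_least)
  also have "\<dots> < stern_ratio l k" using 2 by (simp add: stern_ratio_less)
  also have "\<dots> \<le> stern_sup \<phi>" using 2 assms by (simp add: stern_sup_upper)
  finally show ?thesis .
qed

lemma stern_sup_nonneg:
  assumes "0 \<le> \<theta>" "\<theta> < 1"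
  shows "0 \<le> stern_sup \<theta>"
  using stern_sup_upper[of \<theta> 0 0] assms by simp

text \<open>The preimage is the supremum of the dyadics whose ratio is at most \<open>x\<close>. If
  the value there missed \<open>x\<close>, a ratio strictly between the two would contradict the
  choice of the supremum; such a ratio exists because all nonnegative rationals are ratios.\<close>

lemma stern_sup_surj:
  assumes "0 \<le> x"
  obtains \<theta> where "0 \<le> \<theta>" "\<theta> < 1" "stern_sup \<theta> = x"
proof -
  define S where "S = {real m / 2 ^ n | n m. m < 2 ^ n \<and> stern_ratio n m \<le> x}"
  have upper: "s \<le> real k / 2 ^ l" if s: "s \<in> S" and "k < 2 ^ l" "x < stern_ratio l k" for s k l
  proof (rule ccontr)
    assume *: "\<not> s \<le> real k / 2 ^ l"
    obtain n m where "s = real m / 2 ^ n" "m < 2 ^ n" "stern_ratio n m \<le> x"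
      using s unfolding S_def by blast
    then show False using stern_ratio_less[of m n k l] * that by force
  qed
  obtain l k where lk: "k < 2 ^ l" "x < stern_ratio l k"
    by (rule stern_ratio_dense[of x "x + 1"]) (use assms in auto)
  have bdd: "bdd_above S" by (rule bdd_aboveI[OF upper[OF _ lk]])
  have "real 0 / 2 ^ 0 \<in> S"
    using assms unfolding S_def by (intro CollectI exI[of _ 0]) auto
  then have S0: "0 \<in> S" by simp
  define \<theta> where "\<theta> = Sup S"
  have \<theta>_le: "\<theta> \<le> real j / 2 ^ i" if "j < 2 ^ i" "x < stern_ratio i j" for i j
    unfolding \<theta>_def using S0 upper that by (intro cSup_least) auto
  have le_\<theta>: "s \<le> \<theta>" if "s \<in> S" for s
    unfolding \<theta>_def using bdd that by (simp add: cSup_upper)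
  have "0 \<le> \<theta>" using S0 le_\<theta> by blast
  have "real k < real (2 ^ l)" using lk by (simp only: of_nat_less_iff)
  then have "real k / 2 ^ l < 1" by simp
  then have "\<theta> < 1" using \<theta>_le[OF lk] by linarith
  have "stern_sup \<theta> = x"
  proof (rule linorder_cases)
    assume "stern_sup \<theta> < x"
    then obtain n m where nm: "m < 2 ^ n" "stern_sup \<theta> < stern_ratio n m" "stern_ratio n m < x"
      by (rule stern_ratio_dense[OF stern_sup_nonneg[OF \<open>0 \<le> \<theta>\<close> \<open>\<theta> < 1\<close>]])
    then have "real m / 2 ^ n \<in> S" unfolding S_def by (auto intro: less_imp_le)
    then have "stern_ratio n m \<le> stern_sup \<theta>"
      using nm \<open>\<theta> < 1\<close> le_\<theta> by (simp add: stern_sup_upper)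
    with nm show ?thesis by simp
  next
    assume "x < stern_sup \<theta>"
    then obtain n m where nm: "m < 2 ^ n" "x < stern_ratio n m" "stern_ratio n m < stern_sup \<theta>"
      by (rule stern_ratio_dense[OF assms])
    then have "stern_sup \<theta> \<le> stern_ratio n m"
      using \<theta>_le \<open>0 \<le> \<theta>\<close> by (simp add: stern_sup_least)
    with nm show ?thesis by simp
  qed
  with \<open>0 \<le> \<theta>\<close> \<open>\<theta> < 1\<close> that show thesis by blast
qed

lemma stern_sup_continuous: "continuous_on {0..<1} stern_sup"
proof -
  \<comment> \<open>Extending by the identity makes the image open, so that monotonicity gives continuity.\<close>
  define g where "g \<theta> = (if \<theta> < 0 then \<theta> else stern_sup \<theta>)" for \<theta>
  have "x \<in> g ` {..<1}" for x
  proof (cases "x < 0")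
    case True
    then show ?thesis by (intro image_eqI[of _ _ x]) (auto simp: g_def)
  next
    case False
    then obtain \<theta> where "0 \<le> \<theta>" "\<theta> < 1" "stern_sup \<theta> = x" using stern_sup_surj[of x] by auto
    then show ?thesis by (intro image_eqI[of _ _ \<theta>]) (auto simp: g_def)
  qed
  then have "g ` {..<1} = UNIV" by blast
  moreover have "g \<theta> \<le> g \<phi>" if "\<phi> < 1" "\<theta> \<le> \<phi>" for \<theta> \<phi>
    using that stern_sup_strict_mono[of \<theta> \<phi>] stern_sup_nonneg[of \<phi>]
    by (cases "\<theta> = \<phi>") (auto simp: g_def)
  ultimately have "continuous_on {..<1} g"
    by (intro continuous_onI_mono) auto
  then have "continuous_on {0..<1} g"
    by (rule continuous_on_subset) auto
  then show ?thesis
    by (rule continuous_on_eq) (simp add: g_def)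
qed

lemma assembly_extension_stern_sup: "assembly_extension (restrict stern_sup {0..<1})"
  unfolding assembly_extension_def
proof (intro conjI allI impI)
  show "continuous_on {0..<1} (restrict stern_sup {0..<1})"
    by (rule continuous_on_eq[OF stern_sup_continuous]) simp
  show sm: "strict_mono_on {0..<1} (restrict stern_sup {0..<1})"
    by (auto intro!: strict_mono_onI stern_sup_strict_mono)
  have "restrict stern_sup {0..<1} ` {0..<1} = {0..}"
  proof (intro equalityI subsetI)
    fix x :: real assume "x \<in> {0..}"
    then obtain \<theta> where "0 \<le> \<theta>" "\<theta> < 1" "stern_sup \<theta> = x" using stern_sup_surj[of x] by auto
    then show "x \<in> restrict stern_sup {0..<1} ` {0..<1}"
      by (intro image_eqI[of _ _ \<theta>]) auto
  qed (auto simp: stern_sup_nonneg)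
  then show "bij_betw (restrict stern_sup {0..<1}) {0..<1} {0..}"
    using strict_mono_on_imp_inj_on[OF sm] by (simp add: bij_betw_def)
next
  fix n m :: nat assume m: "m < 2 ^ n"
  then have "real m < real (2 ^ n)" by (simp only: of_nat_less_iff)
  then show "restrict stern_sup {0..<1} (real m / 2 ^ n) = real (stern n m) / real (stern n (2 ^ n - m))"
    using stern_sup_dyadic[OF m] by (simp add: stern_ratio_def)
qed simp

section \<open>Uniqueness and functional equations of the assembly function\<close>

lemma continuous_eq_if_dyadic_eq:
  fixes f g :: "real \<Rightarrow> real"
  assumes "continuous_on {0..<1} f" "continuous_on {0..<1} g"
    and eq: "\<And>n m. m < 2 ^ n \<Longrightarrow> f (real m / 2 ^ n) = g (real m / 2 ^ n)"
    and \<theta>: "0 \<le> \<theta>" "\<theta> < 1"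
  shows "f \<theta> = g \<theta>"
proof -
  \<comment> \<open>Truncating \<open>\<theta>\<close> to \<open>n\<close> binary digits gives
    dyadics in \<open>[0,1)\<close> that converge to \<open>\<theta>\<close> with error at most
    \<open>1 / 2 ^ n\<close>.\<close>
  define K where "K n = nat \<lfloor>2 ^ n * \<theta>\<rfloor>" for n :: nat
  define X where "X n = real (K n) / 2 ^ n" for n
  have K: "real (K n) \<le> 2 ^ n * \<theta>" "2 ^ n * \<theta> - 1 \<le> real (K n)" for n
    using \<theta> by (simp_all add: K_def)
  have X_le: "X n \<le> \<theta>" for n
    using K(1)[of n] by (simp add: X_def field_simps)
  have X_ge: "\<theta> - (1 / 2) ^ n \<le> X n" for n
    using divide_right_mono[OF K(2)[of n], of "2 ^ n"]
    by (simp add: X_def diff_divide_distrib power_one_over)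
  have X_nonneg: "0 \<le> X n" for n
    by (simp add: X_def)
  have X_in: "X n \<in> {0..<1}" for n
    using X_nonneg[of n] X_le[of n] \<theta> by simp
  have "(\<lambda>n. \<theta> - (1 / 2) ^ n) \<longlonglongrightarrow> \<theta> - 0"
    by (intro tendsto_intros LIMSEQ_power_zero) auto
  then have X_lim: "X \<longlonglongrightarrow> \<theta>"
    using X_le X_ge by (intro tendsto_sandwich[of "\<lambda>n. \<theta> - (1 / 2) ^ n" X sequentially "\<lambda>_. \<theta>" \<theta>]) auto
  have lim: "(\<lambda>n. h (X n)) \<longlonglongrightarrow> h \<theta>" if "continuous_on {0..<1} h" for h :: "real \<Rightarrow> real"
    using continuous_on_tendsto_compose[OF that X_lim] \<theta> X_in by simp
  have "f (X n) = g (X n)" for n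
  proof -
    have "real (K n) < real (2 ^ n)" using X_in[of n] by (simp add: X_def)
    then have "K n < 2 ^ n" using of_nat_less_iff by blast
    then show ?thesis unfolding X_def by (rule eq)
  qed
  then have "(\<lambda>n. g (X n)) \<longlonglongrightarrow> f \<theta>" using lim[OF assms(1)] by simp
  then show ?thesis using lim[OF assms(2)] by (rule LIMSEQ_unique)
qed

text \<open>Two extensions agree at the dyadics, hence on \<open>[0,1)\<close> by continuity, and
  outside by extensionality. So the description denotes the restriction of
  \<open>stern_sup\<close>.\<close>

lemma assembly_extension_assembly: "assembly_extension assembly"
  unfolding assembly_def
proof (rule theI[of assembly_extension "restrict stern_sup {0..<1}"])
  show "assembly_extension (restrict stern_sup {0..<1})"
    by (rule assembly_extension_stern_sup)
next
  fix A assume A: "assembly_extension A"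
  let ?B = "restrict stern_sup {0..<1}"
  have B: "assembly_extension ?B" by (rule assembly_extension_stern_sup)
  have dyadic: "A (real m / 2 ^ n) = ?B (real m / 2 ^ n)" if "m < 2 ^ n" for n m
    using A B that unfolding assembly_extension_def by metis
  show "A = ?B"
  proof (rule extensionalityI)
    show "A \<in> extensional {0..<1}" "?B \<in> extensional {0..<1}"
      using A by (simp_all add: assembly_extension_def)
  next
    fix \<theta> :: real assume "\<theta> \<in> {0..<1}"
    then have \<theta>: "0 \<le> \<theta>" "\<theta> < 1" by simp_all
    have "continuous_on {0..<1} A" "continuous_on {0..<1} ?B"
      using A B unfolding assembly_extension_def by blast+
    then show "A \<theta> = ?B \<theta>"
      by (rule continuous_eq_if_dyadic_eq) (use dyadic \<theta> in blast)+
  qed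
qed

lemma continuous_on_assembly: "continuous_on {0..<1} assembly"
  and strict_mono_on_assembly: "strict_mono_on {0..<1} assembly"
  and bij_betw_assembly: "bij_betw assembly {0..<1} {0..}"
  and assembly_dyadic: "m < 2 ^ n \<Longrightarrow> assembly (real m / 2 ^ n) = stern_ratio n m"
  using assembly_extension_assembly unfolding assembly_extension_def stern_ratio_def by blast+

lemma assembly_nonneg: "\<lbrakk>0 \<le> \<theta>; \<theta> < 1\<rbrakk> \<Longrightarrow> 0 \<le> assembly \<theta>"
  using bij_betw_apply[OF bij_betw_assembly] by simp

text \<open>Both sides are continuous, and at the dyadics they agree by
  \<open>stern_ratio_lower_half\<close>. The companion equation for
  \<open>(1 + \<theta>) / 2\<close> follows in the same way from the upper half.\<close>

lemma assembly_half:
  assumes "0 \<le> \<theta>" "\<theta> < 1"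
  shows "assembly (\<theta> / 2) = assembly \<theta> / (1 + assembly \<theta>)"
proof (rule continuous_eq_if_dyadic_eq[where f = "\<lambda>\<theta>. assembly (\<theta> / 2)"
      and g = "\<lambda>\<theta>. assembly \<theta> / (1 + assembly \<theta>)", OF _ _ _ assms])
  show "continuous_on {0..<1} (\<lambda>\<theta>. assembly (\<theta> / 2))"
    by (rule continuous_on_compose2[OF continuous_on_assembly]) (auto intro!: continuous_intros)
  show "continuous_on {0..<1} (\<lambda>\<theta>. assembly \<theta> / (1 + assembly \<theta>))"
    by (intro continuous_intros continuous_on_assembly) (use assembly_nonneg in force)
next
  fix n m :: nat assume m: "m < 2 ^ n"
  then have "assembly (real m / 2 ^ Suc n) = stern_ratio (Suc n) m"
    by (intro assembly_dyadic) simp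
  then show "assembly (real m / 2 ^ n / 2) = assembly (real m / 2 ^ n) / (1 + assembly (real m / 2 ^ n))"
    using m by (simp add: assembly_dyadic stern_ratio_lower_half mult.commute)
qed

lemma assembly_half_plus_half:
  assumes "0 \<le> \<theta>" "\<theta> < 1"
  shows "assembly ((1 + \<theta>) / 2) = 1 + assembly \<theta>"
proof (rule continuous_eq_if_dyadic_eq[where f = "\<lambda>\<theta>. assembly ((1 + \<theta>) / 2)"
      and g = "\<lambda>\<theta>. 1 + assembly \<theta>", OF _ _ _ assms])
  show "continuous_on {0..<1} (\<lambda>\<theta>. assembly ((1 + \<theta>) / 2))"
    by (rule continuous_on_compose2[OF continuous_on_assembly]) (auto intro!: continuous_intros)
  show "continuous_on {0..<1} (\<lambda>\<theta>. 1 + assembly \<theta>)"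
    by (intro continuous_intros continuous_on_assembly)
next
  fix n m :: nat assume m: "m < 2 ^ n"
  then have "assembly (real (2 ^ n + m) / 2 ^ Suc n) = stern_ratio (Suc n) (2 ^ n + m)"
    by (intro assembly_dyadic) simp
  moreover have "real (2 ^ n + m) / 2 ^ Suc n = (1 + real m / 2 ^ n) / 2"
    by (simp add: add_divide_distrib)
  ultimately show "assembly ((1 + real m / 2 ^ n) / 2) = 1 + assembly (real m / 2 ^ n)"
    using m by (simp only: assembly_dyadic stern_ratio_upper_half)
qed

section \<open>Quadratic conjugates\<close>

lemma root_of_quadratic_conjugate:
  fixes x :: real and a b c :: int
  assumes "a \<noteq> 0" "of_int a * x\<^sup>2 + of_int b * x + of_int c = 0"
  shows "of_int a * (- of_int b / of_int a - x)\<^sup>2 + of_int b * (- of_int b / of_int a - x) + of_int c = 0"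
proof -
  define y where "y = - of_int b / of_int a - x"
  have "of_int a * (x + y) = - of_int b" using assms(1) by (simp add: y_def)
  then have "of_int a * y\<^sup>2 + of_int b * y + of_int c = 0"
    using assms(2) by algebra
  then show ?thesis by (simp add: y_def)
qed

text \<open>Integer quadratics vanishing at an irrational \<open>x\<close> are proportional up to
  the constant term forced by \<open>x\<close>, so the sum of the roots, and with it the other root,
  is the same whichever polynomial is chosen.\<close>

lemma quadratic_conjugate_eq:
  fixes a b c :: int
  assumes x: "x \<notin> \<rat>" and a: "a \<noteq> 0" and root: "of_int a * x\<^sup>2 + of_int b * x + of_int c = 0"
  shows "quadratic_conjugate x = - of_int b / of_int a - x"
  unfolding quadratic_conjugate_def
proof (rule the_equality)
  have "- of_int b / of_int a - x \<noteq> x"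
  proof
    assume "- of_int b / of_int a - x = x"
    then have "x = - of_int b / of_int a / 2" by simp
    also have "\<dots> \<in> \<rat>" by simp
    finally show False using x by contradiction
  qed
  then show "- of_int b / of_int a - x \<noteq> x \<and>
     (\<exists>a' b' c' :: int. a' \<noteq> 0 \<and> of_int a' * x\<^sup>2 + of_int b' * x + of_int c' = 0 \<and>
        of_int a' * (- of_int b / of_int a - x)\<^sup>2 + of_int b' * (- of_int b / of_int a - x) + of_int c' = 0)"
    using root_of_quadratic_conjugate[OF a root] a root by blast
next
  fix y
  assume "y \<noteq> x \<and> (\<exists>a' b' c' :: int. a' \<noteq> 0 \<and>
     of_int a' * x\<^sup>2 + of_int b' * x + of_int c' = 0 \<and> of_int a' * y\<^sup>2 + of_int b' * y + of_int c' = 0)"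
  then obtain a' b' c' :: int where "y \<noteq> x" and a': "a' \<noteq> 0"
    and x': "of_int a' * x\<^sup>2 + of_int b' * x + of_int c' = 0"
    and y': "of_int a' * y\<^sup>2 + of_int b' * y + of_int c' = 0" by blast
  have "(y - x) * (of_int a' * (x + y) + of_int b') = 0"
    using x' y' by (simp add: algebra_simps power2_eq_square)
  then have sum: "of_int a' * (x + y) + of_int b' = 0" using \<open>y \<noteq> x\<close> by simp
  \<comment> \<open>Eliminating the square between the two equations at \<open>x\<close> leaves a
    linear equation with integer coefficients; irrationality forces its leading coefficient to
    vanish.\<close>
  have "a' * b - a * b' = 0"
  proof (rule ccontr)
    assume ne: "a' * b - a * b' \<noteq> 0"
    have "of_int (a' * b - a * b') * x = of_int (a * c' - a' * c)"
      using root x' by simp algebra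
    then have "x = of_int (a * c' - a' * c) / of_int (a' * b - a * b')"
      using ne by (simp add: field_simps del: of_int_diff of_int_mult)
    also have "\<dots> \<in> \<rat>" by (intro Rats_divide Rats_of_int)
    finally show False using x by contradiction
  qed
  then have "of_int a' * of_int b = of_int a * (of_int b' :: real)"
    by (metis eq_iff_diff_eq_0 of_int_mult)
  then have "of_int a' * (of_int a * (x + y) + of_int b) = 0" using sum by algebra
  then have "of_int a * (x + y) + of_int b = 0" using a' by simp
  then show "y = - of_int b / of_int a - x" using a by (simp add: field_simps)
qed

section \<open>Purely periodic designs\<close>

lemma summable_design_decimal: "summable (\<lambda>i. of_bool (d i) / 2 ^ Suc i :: real)"
proof (rule summable_comparison_test')
  show "summable (\<lambda>i. (1 / 2) ^ Suc i :: real)" using power_half_series sums_summable by blast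
  show "norm (of_bool (d i) / 2 ^ Suc i :: real) \<le> (1 / 2) ^ Suc i" if "0 \<le> i" for i
    by (simp add: power_one_over)
qed

lemma design_decimal_unfold:
  "design_decimal d = (of_bool (d 0) + design_decimal (\<lambda>i. d (Suc i))) / 2"
proof -
  have "design_decimal d = of_bool (d 0) / 2 + (\<Sum>i. of_bool (d (Suc i)) / 2 ^ Suc (Suc i))"
    unfolding design_decimal_def using suminf_split_head[OF summable_design_decimal[of d]] by simp
  also have "(\<Sum>i. of_bool (d (Suc i)) / 2 ^ Suc (Suc i)) = (\<Sum>i. of_bool (d (Suc i)) / 2 ^ Suc i / (2::real))"
    by (simp add: mult.commute)
  also have "\<dots> = design_decimal (\<lambda>i. d (Suc i)) / 2"
    unfolding design_decimal_def by (rule suminf_divide[OF summable_design_decimal])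
  finally show ?thesis by (simp add: add_divide_distrib)
qed

lemma design_decimal_nonneg: "0 \<le> design_decimal d"
  unfolding design_decimal_def by (intro suminf_nonneg summable_design_decimal) simp

lemma design_decimal_const:
  "design_decimal (\<lambda>_. b) = of_bool b"
  using power_half_series by (auto simp: design_decimal_def power_one_over sums_iff)

text \<open>Comparison with the all-ones design, whose decimal is 1: the difference is a series of
  nonnegative terms that is positive at \<open>k\<close>.\<close>

lemma design_decimal_less_1:
  assumes "\<not> d k"
  shows "design_decimal d < 1"
proof -
  let ?f = "\<lambda>i. of_bool True / 2 ^ Suc i - of_bool (d i) / 2 ^ Suc i :: real"
  have "0 < suminf ?f"
    using assms by (intro suminf_pos2[where i = k] summable_diff summable_design_decimal) (auto simp: field_simps)
  also have "suminf ?f = design_decimal (\<lambda>_. True) - design_decimal d"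
    unfolding design_decimal_def by (rule suminf_diff[symmetric]; rule summable_design_decimal)
  finally show ?thesis by (simp add: design_decimal_const)
qed

lemma infinite_design_shift:
  assumes "infinite_design d"
  shows "infinite_design (\<lambda>i. d (i + k))"
  unfolding infinite_design_def
proof
  assume "\<exists>b N. \<forall>i\<ge>N. d (i + k) = b"
  then obtain b N where "\<forall>i\<ge>N. d (i + k) = b" by blast
  then have "\<forall>i\<ge>N + k. d i = b" by (metis add_le_imp_le_diff le_add_diff_inverse2 le_add2 le_trans)
  with assms show False unfolding infinite_design_def by blast
qed

lemma infinite_design_digit:
  assumes "infinite_design d"
  obtains k where "d k = b"
  using assms unfolding infinite_design_def by (metis (full_types))

lemma design_decimal_bounds:
  assumes "infinite_design d"
  shows "0 \<le> design_decimal d" "design_decimal d < 1"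
  using infinite_design_digit[OF assms, of False] design_decimal_less_1 design_decimal_nonneg by auto

lemma assembly_design_step:
  assumes "infinite_design d"
  shows "assembly (design_decimal d) =
    (if d 0 then 1 + assembly (design_decimal (\<lambda>i. d (Suc i)))
     else assembly (design_decimal (\<lambda>i. d (Suc i))) / (1 + assembly (design_decimal (\<lambda>i. d (Suc i)))))"
proof -
  have "infinite_design (\<lambda>i. d (Suc i))" using infinite_design_shift[OF assms, of 1] by simp
  note * = design_decimal_bounds[OF this]
  show ?thesis
    unfolding design_decimal_unfold[of d] using assembly_half[OF *] assembly_half_plus_half[OF *] by simp
qed

text \<open>The first \<open>k\<close> digits compose to one integer Moebius map applied to the
  tail. A digit 1 adds \<open>a\<close> to \<open>b\<close> and \<open>c\<close> to
  \<open>e\<close>; a digit 0 adds \<open>b\<close> to \<open>a\<close> and \<open>e\<close> to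
  \<open>c\<close>. As \<open>a\<close> and \<open>e\<close> stay at least 1, one occurrence of the
  digit makes \<open>b\<close>, respectively \<open>c\<close>, positive for good.\<close>

lemma assembly_design_moebius:
  assumes d: "infinite_design d"
  defines "x \<equiv> \<lambda>k. assembly (design_decimal (\<lambda>i. d (i + k)))"
  shows "\<exists>a b c e :: int. 1 \<le> a \<and> 1 \<le> e \<and> 0 \<le> b \<and> 0 \<le> c \<and>
    ((\<exists>i<k. d i) \<longrightarrow> 1 \<le> b) \<and> ((\<exists>i<k. \<not> d i) \<longrightarrow> 1 \<le> c) \<and>
    x 0 * (of_int c * x k + of_int e) = of_int a * x k + of_int b"
proof (induction k)
  case 0
  show ?case
    by (rule exI[of _ 1], rule exI[of _ 0], rule exI[of _ 0], rule exI[of _ 1]) simp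
next
  case (Suc k)
  then obtain a b c e :: int where *: "1 \<le> a" "1 \<le> e" "0 \<le> b" "0 \<le> c"
    "(\<exists>i<k. d i) \<longrightarrow> 1 \<le> b" "(\<exists>i<k. \<not> d i) \<longrightarrow> 1 \<le> c"
    and eq: "x 0 * (of_int c * x k + of_int e) = of_int a * x k + of_int b" by blast
  have nonneg: "0 \<le> x (Suc k)"
    unfolding x_def using design_decimal_bounds[OF infinite_design_shift[OF d]] by (intro assembly_nonneg)
  have step: "x k = (if d k then 1 + x (Suc k) else x (Suc k) / (1 + x (Suc k)))"
    unfolding x_def using assembly_design_step[OF infinite_design_shift[OF d, of k]] by simp
  show ?case
  proof (cases "d k")
    case True
    then have "x 0 * (of_int c * x (Suc k) + of_int (c + e)) = of_int a * x (Suc k) + of_int (a + b)"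
      using eq step by (simp add: algebra_simps)
    moreover have "1 \<le> a" "1 \<le> c + e" "0 \<le> a + b" "0 \<le> c" "1 \<le> a + b" "(\<exists>i<Suc k. \<not> d i) \<longrightarrow> 1 \<le> c"
      using * True by (auto simp: less_Suc_eq)
    ultimately show ?thesis by blast
  next
    case False
    then have "x k * (1 + x (Suc k)) = x (Suc k)" using step nonneg by simp
    moreover have "x 0 * (of_int c * (x k * (1 + x (Suc k))) + of_int e * (1 + x (Suc k)))
        = of_int a * (x k * (1 + x (Suc k))) + of_int b * (1 + x (Suc k))"
      using eq by algebra
    ultimately have "x 0 * (of_int c * x (Suc k) + of_int e * (1 + x (Suc k)))
        = of_int a * x (Suc k) + of_int b * (1 + x (Suc k))"
      by simp
    then have "x 0 * (of_int (c + e) * x (Suc k) + of_int e) = of_int (a + b) * x (Suc k) + of_int b"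
      by (simp add: algebra_simps)
    moreover have "1 \<le> a + b" "1 \<le> e" "0 \<le> b" "0 \<le> c + e" "1 \<le> c + e" "(\<exists>i<Suc k. d i) \<longrightarrow> 1 \<le> b"
      using * False by (auto simp: less_Suc_eq)
    ultimately show ?thesis by blast
  qed
qed

lemma conjugate_neg_if_pure:
  assumes "\<omega> \<notin> \<rat>" "0 < \<omega>" "pure_quadratic_irrational \<omega>"
  shows "quadratic_conjugate \<omega> < 0"
proof -
  obtain d P where d: "infinite_design d" and \<omega>: "\<omega> = assembly (design_decimal d)"
    and P: "P \<noteq> []" "\<And>i. d i = P ! (i mod length P)"
    using assms(3) unfolding pure_quadratic_irrational_def purely_periodic_def by blast
  \<comment> \<open>Dropping a whole period leaves the design unchanged, so the Moebius map of that
    period fixes \<open>\<omega>\<close>.\<close>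
  have shift: "(\<lambda>i. d (i + length P)) = d" using P(2) by auto
  \<comment> \<open>Both digits occur within one period, which makes both \<open>b\<close> and
    \<open>c\<close> positive.\<close>
  have ex: "\<exists>i<length P. d i = b" for b
  proof -
    obtain k where "d k = b" using infinite_design_digit[OF d] by blast
    then have "d (k mod length P) = b" using P(2) by simp
    then show ?thesis using P(1) by (intro exI[of _ "k mod length P"]) auto
  qed
  obtain a b c e :: int where "1 \<le> b" and c: "1 \<le> c"
    and eq: "\<omega> * (of_int c * \<omega> + of_int e) = of_int a * \<omega> + of_int b"
    using assembly_design_moebius[OF d, of "length P"] ex[of True] ex[of False]
    by (auto simp: shift \<omega>)
  have root: "of_int c * \<omega>\<^sup>2 + of_int (e - a) * \<omega> + of_int (- b) = 0"
    using eq by (simp add: algebra_simps power2_eq_square)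
  define y where "y = quadratic_conjugate \<omega>"
  have "y = - of_int (e - a) / of_int c - \<omega>"
    unfolding y_def using c by (intro quadratic_conjugate_eq[OF assms(1) _ root]) simp
  then have "of_int c * (y + \<omega>) = - of_int (e - a)" using c by simp
  \<comment> \<open>Vieta for the fixed-point equation: the product of the roots is
    \<open>- b / c\<close>.\<close>
  then have "of_int c * (\<omega> * y) = - of_int b" using root by simp algebra
  also have "\<dots> < 0" using \<open>1 \<le> b\<close> by simp
  finally have "\<omega> * y < 0" using c by (simp add: mult_less_0_iff)
  then show ?thesis using \<open>0 < \<omega>\<close> unfolding y_def by (simp add: mult_less_0_iff)
qed

section \<open>The shift on pairs of conjugates\<close>

text \<open>The branch depends on the first component alone, so that both conjugates undergo the
  same Moebius map.\<close>

definition conj_shift :: "real \<times> real \<Rightarrow> real \<times> real" where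
  "conj_shift = (\<lambda>(x, y). if 1 < x then (x - 1, y - 1) else (x / (1 - x), y / (1 - y)))"

text \<open>These are root pairs of indefinite binary quadratic forms of discriminant
  \<open>D\<close> whose outer coefficients have opposite signs. The coefficients are existentially
  bound because they change along the orbit while \<open>D\<close> persists.\<close>

definition reduced_pairs :: "int \<Rightarrow> (real \<times> real) set" where
  "reduced_pairs D = {(x, y). 0 < x \<and> x \<notin> \<rat> \<and> y < 0 \<and>
     (\<exists>a b c :: int. a \<noteq> 0 \<and> b\<^sup>2 - 4 * a * c = D \<and>
        of_int a * x\<^sup>2 + of_int b * x + of_int c = 0 \<and> of_int a * y\<^sup>2 + of_int b * y + of_int c = 0)}"

lemma reduced_pairsI:
  fixes a b c :: int
  assumes "0 < x" "x \<notin> \<rat>" "y < 0" "a \<noteq> 0" "b\<^sup>2 - 4 * a * c = D"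
    "of_int a * x\<^sup>2 + of_int b * x + of_int c = 0" "of_int a * y\<^sup>2 + of_int b * y + of_int c = 0"
  shows "(x, y) \<in> reduced_pairs D"
  using assms unfolding reduced_pairs_def by blast

text \<open>If \<open>a\<close> vanished, the discriminant would be the square of \<open>b\<close>,
  leaving a genuine linear equation with a rational root. This serves the branch
  \<open>x / (1 - x)\<close>, whose new leading coefficient \<open>a + b + c\<close> is not visibly
  nonzero.\<close>

lemma quadratic_leading_nonzero:
  fixes a b c :: int and x :: real
  assumes "x \<notin> \<rat>" "b\<^sup>2 - 4 * a * c \<noteq> 0" "of_int a * x\<^sup>2 + of_int b * x + of_int c = 0"
  shows "a \<noteq> 0"
proof
  assume "a = 0"
  then have "b \<noteq> 0" using assms(2) by auto
  then have "x = - of_int c / of_int b" using assms(3) \<open>a = 0\<close> by (simp add: field_simps)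
  also have "\<dots> \<in> \<rat>" by simp
  finally show False using assms(1) by contradiction
qed

lemma distinct_roots_Vieta:
  fixes a b c x y :: real
  assumes "a \<noteq> 0" "x \<noteq> y" "a * x\<^sup>2 + b * x + c = 0" "a * y\<^sup>2 + b * y + c = 0"
  shows "a * (x + y) = - b" "a * (x * y) = c"
proof -
  have "(x - y) * (a * (x + y) + b) = 0"
    using assms(3,4) by (simp add: algebra_simps power2_eq_square)
  then show "a * (x + y) = - b" using assms(2) by simp
  then show "a * (x * y) = c" using assms(3) by algebra
qed

text \<open>Both branches are substitutions of determinant 1, so they preserve the discriminant.
  They also keep the first root positive and the second negative.\<close>

lemma conj_shift_reduced:
  assumes "z \<in> reduced_pairs D"
  shows "conj_shift z \<in> reduced_pairs D"
proof -
  obtain x y a b c where z: "z = (x, y)" and xy: "0 < x" "x \<notin> \<rat>" "y < 0" and "a \<noteq> 0"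
    and D: "b\<^sup>2 - 4 * a * c = D"
    and rx: "of_int a * x\<^sup>2 + of_int b * x + of_int c = 0"
    and ry: "of_int a * y\<^sup>2 + of_int b * y + of_int c = 0"
    using assms unfolding reduced_pairs_def by blast
  show ?thesis
  proof (cases "1 < x")
    case True
    have "x - 1 \<notin> \<rat>" using xy(2) Rats_add[of "x - 1" 1] by auto
    \<comment> \<open>The new coefficients come from substituting \<open>w + 1\<close> for the
      variable.\<close>
    moreover have "(2 * a + b)\<^sup>2 - 4 * a * (a + b + c) = D"
      using D by (simp add: algebra_simps power2_eq_square)
    moreover have "of_int a * (x - 1)\<^sup>2 + of_int (2 * a + b) * (x - 1) + of_int (a + b + c) = 0"
      "of_int a * (y - 1)\<^sup>2 + of_int (2 * a + b) * (y - 1) + of_int (a + b + c) = 0"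
      using rx ry by (simp_all add: algebra_simps power2_eq_square)
    moreover have "0 < x - 1" "y - 1 < 0" using True xy by auto
    moreover have "conj_shift z = (x - 1, y - 1)" using True by (simp add: z conj_shift_def)
    ultimately show ?thesis
      using \<open>a \<noteq> 0\<close> by (metis reduced_pairsI)
  next
    case False
    have "x \<noteq> 1" using xy(2) by auto
    then have "x < 1" using False by simp
    define u where "u = x / (1 - x)"
    define v where "v = y / (1 - y)"
    have u: "x * (1 + u) = u" "u * (1 - x) = x" "0 < u" and v: "y * (1 + v) = v" "v * (1 - y) = y" "v < 0"
      using \<open>x < 1\<close> xy by (simp_all add: u_def v_def divide_simps)
    have "u \<notin> \<rat>"
    proof
      assume "u \<in> \<rat>"
      then have "u / (1 + u) \<in> \<rat>" by simp
      moreover have "x = u / (1 + u)" using u by (simp add: field_simps)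
      ultimately show False using xy(2) by simp
    qed
    have D': "(b + 2 * c)\<^sup>2 - 4 * (a + b + c) * c = D"
      using D by (simp add: algebra_simps power2_eq_square)
    \<comment> \<open>The new coefficients come from substituting \<open>w / (1 + w)\<close> and
      clearing denominators.\<close>
    have shifted: "of_int (a + b + c) * w\<^sup>2 + of_int (b + 2 * c) * w + of_int c = 0"
      if t: "t * (1 + w) = w" and r: "of_int a * t\<^sup>2 + of_int b * t + of_int c = 0" for t w :: real
    proof -
      have "of_int a * (t * (1 + w))\<^sup>2 + of_int b * (t * (1 + w)) * (1 + w) + of_int c * (1 + w)\<^sup>2 = 0"
        using r by algebra
      then show ?thesis unfolding t by (simp add: algebra_simps power2_eq_square)
    qed
    \<comment> \<open>The discriminant is the square of \<open>a * (x - y)\<close>, and roots of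
      opposite sign are distinct.\<close>
    have "b\<^sup>2 - 4 * a * c \<noteq> 0"
    proof
      assume 0: "b\<^sup>2 - 4 * a * c = 0"
      have "of_int b = - (of_int a * (x + y))" "of_int c = of_int a * (x * y)"
        using distinct_roots_Vieta[of "of_int a" x y "of_int b" "of_int c"] \<open>a \<noteq> 0\<close> xy rx ry by simp_all
      then have "real_of_int a * (x - y) * (of_int a * (x - y)) = of_int b * of_int b - 4 * of_int a * of_int c"
        by (simp only:) (simp add: algebra_simps)
      also have "\<dots> = of_int (b\<^sup>2 - 4 * a * c)" by (simp add: power2_eq_square)
      finally show False using 0 xy \<open>a \<noteq> 0\<close> by auto
    qed
    then have "a + b + c \<noteq> 0"
      using quadratic_leading_nonzero[OF \<open>u \<notin> \<rat>\<close> _ shifted[OF u(1) rx]] D D' by simp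
    moreover have "conj_shift z = (u, v)" using False by (simp add: z conj_shift_def u_def v_def)
    ultimately show ?thesis
      using reduced_pairsI[OF u(3) \<open>u \<notin> \<rat>\<close> v(3) _ D' shifted[OF u(1) rx] shifted[OF v(1) ry]] by simp
  qed
qed

text \<open>The second component of the image tells the two branches apart: it is below \<open>-1\<close> exactly
  when the first branch was taken.\<close>

lemma inj_on_conj_shift: "inj_on conj_shift (reduced_pairs D)"
proof (rule inj_onI)
  fix z w assume z: "z \<in> reduced_pairs D" and w: "w \<in> reduced_pairs D" and eq: "conj_shift z = conj_shift w"
  have branch: "(1 < fst z \<longleftrightarrow> snd (conj_shift z) < - 1) \<and>
     z = (if 1 < fst z then (fst (conj_shift z) + 1, snd (conj_shift z) + 1)
       else (fst (conj_shift z) / (1 + fst (conj_shift z)), snd (conj_shift z) / (1 + snd (conj_shift z))))"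
    if "z \<in> reduced_pairs D" for z
  proof -
    obtain x y where *: "z = (x, y)" "0 < x" "x \<notin> \<rat>" "y < 0"
      using \<open>z \<in> reduced_pairs D\<close> unfolding reduced_pairs_def by blast
    then have "x \<noteq> 1" by auto
    then show ?thesis using * by (auto simp: conj_shift_def field_simps)
  qed
  show "z = w" using branch[OF z] branch[OF w] unfolding eq by metis
qed

section \<open>Finiteness of the reduced pairs and periodicity of orbits\<close>

lemma finite_quadratic_roots:
  fixes a b c :: real
  assumes "a \<noteq> 0"
  shows "finite {x. a * x\<^sup>2 + b * x + c = 0}"
proof (rule finite_subset)
  show "{x. a * x\<^sup>2 + b * x + c = 0} \<subseteq>
    {(- b + sqrt (discrim a b c)) / (2 * a), (- b - sqrt (discrim a b c)) / (2 * a)}"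
    using discriminant_iff[OF assms] by auto
qed simp

text \<open>Roots of opposite sign force \<open>a * c < 0\<close>, so \<open>D\<close> equals the
  square of \<open>b\<close> plus \<open>4 * \<bar>a * c\<bar>\<close>. This bounds all three
  coefficients by \<open>D\<close>, and each quadratic has finitely many roots.\<close>

lemma finite_reduced_pairs: "finite (reduced_pairs D)"
proof -
  define R where "R = (\<lambda>(a, b, c). {x :: real. of_int a * x\<^sup>2 + of_int b * x + of_int c = 0})"
  define I where "I = {t \<in> {-D..D} \<times> {-D..D} \<times> {-D..D}. fst t \<noteq> 0}"
  have "finite (\<Union>t\<in>I. R t \<times> R t)"
  proof (rule finite_UN_I)
    show "finite I" unfolding I_def by simp
    show "finite (R t \<times> R t)" if "t \<in> I" for t
      using that finite_quadratic_roots unfolding R_def I_def by auto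
  qed
  moreover have "reduced_pairs D \<subseteq> (\<Union>t\<in>I. R t \<times> R t)"
  proof
    fix z assume "z \<in> reduced_pairs D"
    then obtain x y a b c where z: "z = (x, y)" and xy: "0 < x" "x \<notin> \<rat>" "y < 0" and "a \<noteq> 0"
      and D: "b\<^sup>2 - 4 * a * c = D"
      and rx: "of_int a * x\<^sup>2 + of_int b * x + of_int c = 0"
      and ry: "of_int a * y\<^sup>2 + of_int b * y + of_int c = 0"
      unfolding reduced_pairs_def by blast
    \<comment> \<open>The extra factor \<open>a\<close> makes the sign of \<open>x * y\<close>
      decide that of \<open>a * c\<close>, whatever the sign of \<open>a\<close>.\<close>
    have "real_of_int a * (of_int a * (x * y)) = of_int a * of_int c"
      using distinct_roots_Vieta(2)[of "of_int a" x y "of_int b" "of_int c"] \<open>a \<noteq> 0\<close> xy rx ry by simp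
    moreover have "real_of_int a * (of_int a * (x * y)) < 0"
      using \<open>a \<noteq> 0\<close> xy by (auto simp: mult_less_0_iff zero_less_mult_iff)
    ultimately have "real_of_int (a * c) < 0" unfolding of_int_mult by linarith
    then have ac: "a * c < 0" by linarith
    have "\<bar>a\<bar> * \<bar>c\<bar> = - (a * c)" using ac by (simp add: abs_mult[symmetric])
    moreover have "\<bar>a\<bar> * 1 \<le> \<bar>a\<bar> * \<bar>c\<bar>" "1 * \<bar>c\<bar> \<le> \<bar>a\<bar> * \<bar>c\<bar>"
    proof -
      have "1 \<le> \<bar>a\<bar>" "1 \<le> \<bar>c\<bar>" using ac by (auto simp: int_one_le_iff_zero_less)
      then show "\<bar>a\<bar> * 1 \<le> \<bar>a\<bar> * \<bar>c\<bar>" "1 * \<bar>c\<bar> \<le> \<bar>a\<bar> * \<bar>c\<bar>"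
        by (intro mult_left_mono mult_right_mono; simp)+
    qed
    moreover have "\<bar>b\<bar> \<le> b\<^sup>2"
    proof (cases "b = 0")
      case False
      then have "\<bar>b\<bar> * 1 \<le> \<bar>b\<bar> * \<bar>b\<bar>" by (intro mult_left_mono) auto
      then show ?thesis by (simp add: power2_eq_square)
    qed simp
    ultimately have "\<bar>a\<bar> \<le> D" "\<bar>b\<bar> \<le> D" "\<bar>c\<bar> \<le> D" using D ac zero_le_power2[of b] by linarith+
    then have "(a, b, c) \<in> I" using \<open>a \<noteq> 0\<close> by (auto simp: I_def)
    moreover have "z \<in> R (a, b, c) \<times> R (a, b, c)" using rx ry by (simp add: R_def z)
    ultimately show "z \<in> (\<Union>t\<in>I. R t \<times> R t)" by blast
  qed
  ultimately show ?thesis by (rule finite_subset[rotated])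
qed

text \<open>The pigeonhole principle gives a repetition; injectivity cancels the steps before it, so
  the orbit is periodic from its very start.\<close>

lemma finite_inj_on_periodic:
  assumes "finite S" "inj_on f S" "f ` S \<subseteq> S" "z \<in> S"
  obtains p where "0 < p" "(f ^^ p) z = z"
proof -
  have in_S: "(f ^^ k) z \<in> S" for k
    using assms(3,4) by (induction k) auto
  have "\<not> inj (\<lambda>k. (f ^^ k) z)"
    using finite_subset[OF _ assms(1), of "range (\<lambda>k. (f ^^ k) z)"] in_S finite_imageD by blast
  then obtain i j where "i < j" and eq: "(f ^^ i) z = (f ^^ j) z"
    by (metis injI linorder_neqE_nat)
  then obtain p where p: "0 < p" "j = i + p" using less_imp_add_positive by blast
  have "(f ^^ i) z = (f ^^ (i + p)) z" using eq p by simp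
  then have "z = (f ^^ p) z"
  proof (induction i)
    case (Suc i)
    then have "f ((f ^^ i) z) = f ((f ^^ (i + p)) z)" by simp
    then have "(f ^^ i) z = (f ^^ (i + p)) z" using assms(2) in_S by (meson inj_onD)
    then show ?case by (rule Suc.IH)
  qed simp
  with p that show thesis by metis
qed

section \<open>Recovering the design from the orbit\<close>

lemma assembly_zero: "assembly 0 = 0"
  using assembly_dyadic[of 0 0] by simp

lemma assembly_one_half: "assembly (1 / 2) = 1"
  using assembly_half_plus_half[of 0] by (simp add: assembly_zero)

lemma assembly_less_iff:
  assumes "0 \<le> \<theta>" "\<theta> < 1" "0 \<le> \<phi>" "\<phi> < 1"
  shows "assembly \<theta> < assembly \<phi> \<longleftrightarrow> \<theta> < \<phi>"
  using strict_mono_on_less[OF strict_mono_on_assembly, of \<theta> \<phi>] assms by simp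

text \<open>Since \<open>assembly (1 / 2) = 1\<close> and the function is increasing, comparing
  \<open>x\<close> with 1 reads off the first binary digit of \<open>\<theta>\<close>; doubling and
  removing that digit then corresponds to one shift.\<close>

lemma assembly_shift:
  assumes \<theta>: "0 \<le> \<theta>" "\<theta> < 1" and "assembly \<theta> = x" "x \<noteq> 1"
  defines "\<theta>' \<equiv> 2 * \<theta> - of_bool (1 < x)"
  shows "0 \<le> \<theta>' \<and> \<theta>' < 1 \<and> assembly \<theta>' = fst (conj_shift (x, y))"
proof (cases "1 < x")
  case True
  then have "1 / 2 < \<theta>"
    using assembly_less_iff[of "1 / 2" \<theta>] assms by (simp add: assembly_one_half)
  then have *: "0 \<le> \<theta>'" "\<theta>' < 1" using True \<theta> by (auto simp: \<theta>'_def)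
  have "(1 + \<theta>') / 2 = \<theta>" using True by (simp add: \<theta>'_def)
  with assembly_half_plus_half[OF *] show ?thesis
    using * True assms by (simp add: conj_shift_def)
next
  case False
  then have "\<theta> < 1 / 2"
    using assembly_less_iff[of \<theta> "1 / 2"] assms by (simp add: assembly_one_half)
  then have *: "0 \<le> \<theta>'" "\<theta>' < 1" using False \<theta> by (auto simp: \<theta>'_def)
  have "\<theta>' / 2 = \<theta>" using False by (simp add: \<theta>'_def)
  then have x: "x = assembly \<theta>' / (1 + assembly \<theta>')" using assembly_half[OF *] assms by simp
  have "0 \<le> assembly \<theta>'" using * by (rule assembly_nonneg)
  then have "x / (1 - x) = assembly \<theta>'" unfolding x by (simp add: field_simps)
  then show ?thesis using * False by (simp add: conj_shift_def)
qed

lemma design_decimal_orbit: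
  assumes "0 \<le> \<theta>" "\<theta> < 1" "(assembly \<theta>, y) \<in> reduced_pairs D"
  defines "z \<equiv> \<lambda>k. (conj_shift ^^ k) (assembly \<theta>, y)"
  shows "design_decimal (\<lambda>k. 1 < fst (z k)) = \<theta>"
proof -
  define s where "s k = (\<Sum>i<k. of_bool (1 < fst (z i)) / 2 ^ Suc i :: real)" for k
  \<comment> \<open>The remainder of \<open>\<theta>\<close> after \<open>k\<close> digits,
    rescaled. That it stays in \<open>[0,1)\<close> yields the error bound for the partial sums
    \<open>s k\<close>, and \<open>assembly (t k) = fst (z k)\<close> carries the induction.\<close>
  define t where "t k = 2 ^ k * (\<theta> - s k)" for k
  have z_reduced: "z k \<in> reduced_pairs D" for k
    unfolding z_def using assms(3) by (induction k) (auto intro: conj_shift_reduced)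
  have t: "0 \<le> t k \<and> t k < 1 \<and> assembly (t k) = fst (z k)" for k
  proof (induction k)
    case 0
    show ?case using assms(1,2) by (simp add: t_def s_def z_def)
  next
    case (Suc k)
    have "t (Suc k) = 2 * t k - of_bool (1 < fst (z k))"
      by (simp add: t_def s_def algebra_simps)
    moreover have "fst (z k) \<noteq> 1"
      using z_reduced[of k] unfolding reduced_pairs_def by auto
    moreover have "z (Suc k) = conj_shift (fst (z k), snd (z k))"
      by (simp add: z_def)
    ultimately show ?case
      using assembly_shift[of "t k" "fst (z k)" "snd (z k)"] Suc by simp
  qed
  have "\<theta> - s k = t k * (1 / 2) ^ k" for k
    by (simp add: t_def power_one_over)
  then have "0 \<le> \<theta> - s k \<and> \<theta> - s k \<le> (1 / 2) ^ k" for k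
    using t[of k] by (simp add: mult_left_le_one_le)
  then have "\<theta> - (1 / 2) ^ k \<le> s k" "s k \<le> \<theta>" for k
    by (smt (verit))+
  moreover have "(\<lambda>k. \<theta> - (1 / 2) ^ k) \<longlonglongrightarrow> \<theta> - 0"
    by (intro tendsto_intros LIMSEQ_power_zero) auto
  ultimately have "s \<longlonglongrightarrow> \<theta>"
    by (intro tendsto_sandwich[of "\<lambda>k. \<theta> - (1 / 2) ^ k" s sequentially "\<lambda>_. \<theta>" \<theta>]) auto
  then show ?thesis
    unfolding design_decimal_def s_def by (intro sums_unique[symmetric]) (simp add: sums_def)
qed

lemma pure_if_reduced:
  assumes \<theta>: "0 \<le> \<theta>" "\<theta> < 1" and z: "(assembly \<theta>, y) \<in> reduced_pairs D"
  shows "pure_quadratic_irrational (assembly \<theta>)"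
proof -
  obtain p where p: "0 < p" "(conj_shift ^^ p) (assembly \<theta>, y) = (assembly \<theta>, y)"
    using finite_inj_on_periodic[OF finite_reduced_pairs inj_on_conj_shift _ z] conj_shift_reduced by blast
  define d where "d k \<longleftrightarrow> 1 < fst ((conj_shift ^^ k) (assembly \<theta>, y))" for k
  have dec: "design_decimal d = \<theta>" unfolding d_def using design_decimal_orbit[OF \<theta> z] by simp
  have d_add: "d (k + p) = d k" for k
    by (simp add: d_def funpow_add p)
  have d_mult: "d (k + p * n) = d k" for k n
    by (induction n) (use d_add in \<open>auto simp: add.assoc[symmetric] add.commute[of p]\<close>)
  have d_mod: "d k = d (k mod p)" for k
    using d_mult[of "k mod p" "k div p"] by simp
  have "purely_periodic d"
    unfolding purely_periodic_def
    by (rule exI[of _ "map d [0..<p]"]) (use p(1) d_mod in simp)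
  moreover have "infinite_design d"
    unfolding infinite_design_def
  proof
    assume "\<exists>b N. \<forall>i\<ge>N. d i = b"
    then obtain b N where "\<And>i. N \<le> i \<Longrightarrow> d i = b" by blast
    \<comment> \<open>Adding whole periods moves any index past \<open>N\<close>, so an eventually
      constant design would be constant.\<close>
    moreover have "N \<le> k + p * N" for k using p(1) by (simp add: trans_le_add2)
    ultimately have "d = (\<lambda>_. b)" using d_mult by metis
    then have "\<theta> = of_bool b" using dec by (simp add: design_decimal_const)
    \<comment> \<open>The value 1 is excluded by \<open>\<theta> < 1\<close>, and the value 0 would
      give \<open>assembly \<theta> = 0\<close>, against positivity in a reduced pair.\<close>
    then have "\<theta> = 0" using \<theta> by (cases b) auto
    then show False using z by (simp add: assembly_zero reduced_pairs_def)
  qed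
  ultimately show ?thesis
    unfolding pure_quadratic_irrational_def using \<theta> dec by (intro bexI[of _ \<theta>] conjI exI[of _ d]) auto
qed

theorem theorem7p9:
  fixes \<theta> \<omega> \<omega>' :: real
  assumes "\<theta> \<in> {0..<1}" and "\<omega> = assembly \<theta>"
    and "\<omega> > 0" and "quadratic_irrational \<omega>"
    and "\<omega>' = quadratic_conjugate \<omega>"
  shows "(pure_quadratic_irrational \<omega> \<longleftrightarrow> \<omega>' < 0) \<and>
         (nonpure_quadratic_irrational \<omega> \<longleftrightarrow> \<omega>' > 0)"
proof -
  obtain a b c :: int where irr: "\<omega> \<notin> \<rat>" and a: "a \<noteq> 0"
    and root: "of_int a * \<omega>\<^sup>2 + of_int b * \<omega> + of_int c = 0"
    using assms(4) unfolding quadratic_irrational_def by blast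
  have conj: "\<omega>' = - of_int b / of_int a - \<omega>"
    using quadratic_conjugate_eq[OF irr a root] assms(5) by simp
  have root': "of_int a * \<omega>'\<^sup>2 + of_int b * \<omega>' + of_int c = 0"
    unfolding conj by (rule root_of_quadratic_conjugate[OF a root])
  \<comment> \<open>A zero conjugate would make \<open>\<omega>\<close> rational. Hence
    \<open>\<omega>' > 0\<close> is the negation of \<open>\<omega>' < 0\<close>, and the second
    equivalence follows from the first.\<close>
  have "\<omega>' \<noteq> 0"
  proof
    assume "\<omega>' = 0"
    then have "\<omega> = - of_int b / of_int a" using conj by simp
    also have "\<dots> \<in> \<rat>" by simp
    finally show False using irr by contradiction
  qed
  moreover have "pure_quadratic_irrational \<omega> \<longleftrightarrow> \<omega>' < 0"
  proof
    assume "pure_quadratic_irrational \<omega>"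
    then show "\<omega>' < 0" using conjugate_neg_if_pure irr assms by simp
  next
    assume "\<omega>' < 0"
    then have "(assembly \<theta>, \<omega>') \<in> reduced_pairs (b\<^sup>2 - 4 * a * c)"
      using reduced_pairsI[OF assms(3) irr _ a refl root root'] assms(2) by simp
    then show "pure_quadratic_irrational \<omega>"
      using pure_if_reduced assms by simp
  qed
  ultimately show ?thesis
    using assms(4) unfolding nonpure_quadratic_irrational_def by auto
qed

end
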